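(* Let $P$ be any arithmetic progression of length $n$ (of real numbers, with nonzero common difference). Then, as $n\to\infty$, \[ \frac1{2^n}\sum_{S\subseteq P}|S-S|\sim 2n-7,\qquad \frac1{2^n}\sum_{S\subseteq P}|S+S|\sim 2n-11. \] (On average, the difference set of a subset of $P$ has 4 more elements than its sumset.)
   Context: For a finite set $S$, $S+S=\{s_1+s_2: s_1,s_2\in S\}$ and $S-S=\{s_1-s_2: s_1,s_2\in S\}$. The sums range over all $2^n$ subsets $S$ of $P$, including the empty set. *)

theory Defs
  imports Complex_Main "HOL-Library.Landau_Symbols"
begin

definition arith_prog :: "nat \<Rightarrow> real set \<Rightarrow> bool" where
  "arith_prog n P \<longleftrightarrow> (\<exists>a d. d \<noteq> 0 \<and> P = (\<lambda>k. a + real k * d) ` {..<n})"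

definition sumset :: "real set \<Rightarrow> real set" where
  "sumset S = {s\<^sub>1 + s\<^sub>2 | s\<^sub>1 s\<^sub>2. s\<^sub>1 \<in> S \<and> s\<^sub>2 \<in> S}"

(* Not the operator (-) on sets, which is set-theoretic difference. *)
definition diffset :: "real set \<Rightarrow> real set" where
  "diffset S = {s\<^sub>1 - s\<^sub>2 | s\<^sub>1 s\<^sub>2. s\<^sub>1 \<in> S \<and> s\<^sub>2 \<in> S}"

definition mean_sumset_size :: "nat \<Rightarrow> real set \<Rightarrow> real" where
  "mean_sumset_size n P = 1 / 2 ^ n * (\<Sum>S\<in>Pow P. real (card (sumset S)))"

definition mean_diffset_size :: "nat \<Rightarrow> real set \<Rightarrow> real" where
  "mean_diffset_size n P = 1 / 2 ^ n * (\<Sum>S\<in>Pow P. real (card (diffset S)))"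

end

theory Submission
  imports Defs "HOL-Library.Disjoint_Sets" "HOL-Analysis.Elementary_Normed_Spaces" "HOL-Real_Asymp.Real_Asymp"
begin

text \<open>
  Count, for each possible sum or difference \<open>x\<close>, the proportion of subsets \<open>S\<close> that miss it.
  Missing \<open>x\<close> means that \<open>S\<close> contains none of the pairs representing \<open>x\<close>; when these pairs are
  disjoint, the events are independent, each pair of distinct elements contributing a factor
  \<open>3/4\<close> and a single element a factor \<open>1/2\<close>.

  For sums the pairs are always disjoint. The proportions for the \<open>k\<close>-th sum from either end are
  \<open>1/2, 3/4, 1/2 (3/4), (3/4)\<^sup>2, \<dots>\<close>, with total \<open>5\<close>, so on average \<open>10\<close> of the \<open>2 n - 1\<close>
  sums are missed. The difference \<open>k d\<close> is represented by \<open>n - k\<close> pairs, which are disjoint if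
  \<open>n \<le> 2 k\<close>; these proportions add up to \<open>3\<close> for either sign. If \<open>2 k \<le> n\<close> there are still at
  least \<open>n/4\<close> disjoint pairs, so the contribution is exponentially small.
\<close>

section \<open>Uniformly random subsets and independence of disjoint blocks\<close>

definition share :: "'a set \<Rightarrow> ('a set \<Rightarrow> bool) \<Rightarrow> real" where
  "share U Q = real (card {S \<in> Pow U. Q S}) / 2 ^ card U"

lemma share_nonneg: "share U Q \<ge> 0"
  by (simp add: share_def)

lemma share_cong: "(\<And>S. S \<subseteq> U \<Longrightarrow> Q S \<longleftrightarrow> R S) \<Longrightarrow> share U Q = share U R"
  unfolding share_def by (rule arg_cong[where f = "\<lambda>X. real (card X) / 2 ^ card U"]) auto

lemma share_mono:
  assumes "finite U" "\<And>S. S \<subseteq> U \<Longrightarrow> Q S \<Longrightarrow> R S"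
  shows "share U Q \<le> share U R"
proof -
  have "card {S \<in> Pow U. Q S} \<le> card {S \<in> Pow U. R S}"
    using assms by (intro card_mono) auto
  then show ?thesis
    by (simp add: share_def divide_right_mono)
qed

text \<open>The traces of a random \<open>S\<close> on disjoint blocks are independent and uniform,
  and only one of the \<open>2 ^ card (A i)\<close> traces on \<open>A i\<close> is forbidden,
  namely \<open>A i\<close> itself. The induction removes one block together with its elements, so
  the ground set \<open>U\<close> has to vary.\<close>

lemma share_no_block:
  assumes "finite I" "finite U" "\<And>i. i \<in> I \<Longrightarrow> A i \<subseteq> U" "disjoint_family_on A I"
  shows "share U (\<lambda>S. \<forall>i\<in>I. \<not> A i \<subseteq> S) = (\<Prod>i\<in>I. 1 - 1 / 2 ^ card (A i))"
  using assms
proof (induction I arbitrary: U rule: finite_induct)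
  case empty
  then show ?case by (simp add: share_def flip: Pow_def) (simp add: card_Pow)
next
  case (insert i I)
  define V where "V = U - A i"
  have AU: "A i \<subseteq> U" and finA: "finite (A i)"
    using insert.prems finite_subset by blast+
  have disj: "A j \<inter> A i = {}" if "j \<in> I" for j
    using insert.prems(3) insert.hyps that by (auto simp: disjoint_family_on_def)
  have IH: "share V (\<lambda>S. \<forall>j\<in>I. \<not> A j \<subseteq> S) = (\<Prod>j\<in>I. 1 - 1 / 2 ^ card (A j))"
  proof (rule insert.IH)
    show "A j \<subseteq> V" if "j \<in> I" for j
      using disj[OF that] insert.prems(2) that by (auto simp: V_def)
    show "disjoint_family_on A I"
      using insert.prems(3) by (auto simp: disjoint_family_on_def)
  qed (use insert.prems in \<open>auto simp: V_def\<close>)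
  \<comment> \<open>\<open>S\<close> is determined by its traces on \<open>A i\<close> and on the
    rest \<open>V\<close>. The first has to be a proper subset of \<open>A i\<close>; the remaining
    conditions concern only the second.\<close>
  have "bij_betw (\<lambda>S. (S \<inter> A i, S \<inter> V)) {S \<in> Pow U. \<forall>j\<in>insert i I. \<not> A j \<subseteq> S}
          ((Pow (A i) - {A i}) \<times> {S \<in> Pow V. \<forall>j\<in>I. \<not> A j \<subseteq> S})"
  proof (rule bij_betwI[where g = "\<lambda>(X, Y). X \<union> Y"], goal_cases)
    case 1
    have "\<not> A j \<subseteq> S \<inter> V" if "j \<in> I" "\<not> A j \<subseteq> S" for j S using that by blast
    then show ?case by auto
  next
    case 2
    have "\<not> A j \<subseteq> X \<union> Y" if "j \<in> I" "X \<subseteq> A i" "\<not> A j \<subseteq> Y" for j X Y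
      using that disj[of j] by blast
    moreover have "\<not> A i \<subseteq> X \<union> Y" if "X \<subseteq> A i" "X \<noteq> A i" "Y \<subseteq> V" for X Y
      using that unfolding V_def by blast
    ultimately show ?case using AU by (auto simp: V_def)
  next
    case (3 S)
    then show ?case by (auto simp: V_def)
  next
    case (4 Z)
    then show ?case by (auto simp: V_def)
  qed
  from bij_betw_same_card[OF this]
  have "card {S \<in> Pow U. \<forall>j\<in>insert i I. \<not> A j \<subseteq> S}
      = (2 ^ card (A i) - 1) * card {S \<in> Pow V. \<forall>j\<in>I. \<not> A j \<subseteq> S}"
    using finA by (simp add: card_cartesian_product card_Diff_singleton card_Pow)
  moreover have "card U = card (A i) + card V"
    using AU \<open>finite U\<close> finA by (simp add: V_def card_Diff_subset card_mono)
  ultimately have "share U (\<lambda>S. \<forall>j\<in>insert i I. \<not> A j \<subseteq> S)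
      = (1 - 1 / 2 ^ card (A i)) * share V (\<lambda>S. \<forall>j\<in>I. \<not> A j \<subseteq> S)"
    by (simp add: share_def power_add of_nat_diff field_simps)
  then show ?case
    using IH insert.hyps by simp
qed

text \<open>Double counting: the elements of \<open>T\<close> missed by \<open>F S\<close> are
  counted with indicator functions, and the two sums are exchanged.\<close>

lemma mean_card_eq:
  assumes "finite U" "finite T" "\<And>S. S \<subseteq> U \<Longrightarrow> F S \<subseteq> T"
  shows "1 / 2 ^ card U * (\<Sum>S\<in>Pow U. real (card (F S)))
       = real (card T) - (\<Sum>x\<in>T. share U (\<lambda>S. x \<notin> F S))"
proof -
  have "real (card (F S)) = real (card T) - (\<Sum>x\<in>T. of_bool (x \<notin> F S))" if "S \<in> Pow U" for S
  proof -
    have "F S \<subseteq> T" using assms(3) that by simp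
    then have "real (card (T - F S)) = real (card T) - real (card (F S))"
      using assms(2) by (simp add: card_Diff_subset finite_subset card_mono of_nat_diff)
    moreover have "(\<Sum>x\<in>T. of_bool (x \<notin> F S)) = real (card (T - F S))"
      using assms(2) by (simp add: sum.If_cases of_bool_def Diff_eq Compl_eq)
    ultimately show ?thesis by simp
  qed
  then have "(\<Sum>S\<in>Pow U. real (card (F S)))
      = 2 ^ card U * real (card T) - (\<Sum>S\<in>Pow U. \<Sum>x\<in>T. of_bool (x \<notin> F S))"
    using assms(1) by (simp add: sum_subtractf card_Pow)
  also have "(\<Sum>S\<in>Pow U. \<Sum>x\<in>T. of_bool (x \<notin> F S))
      = (\<Sum>x\<in>T. \<Sum>S\<in>Pow U. of_bool (x \<notin> F S))"
    by (rule sum.swap)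
  also have "\<dots> = (\<Sum>x\<in>T. 2 ^ card U * share U (\<lambda>S. x \<notin> F S))"
    using assms(1) by (intro sum.cong refl)
      (simp add: share_def sum.If_cases of_bool_def Int_def)
  finally show ?thesis
    by (simp add: field_simps flip: sum_distrib_left)
qed

section \<open>Arithmetic progressions and their reversal\<close>

definition progression :: "real \<Rightarrow> real \<Rightarrow> nat \<Rightarrow> real set" where
  "progression a d n = (\<lambda>k. a + real k * d) ` {..<n}"

lemma finite_progression [simp]: "finite (progression a d n)"
  by (simp add: progression_def)

lemma card_progression [simp]: "d \<noteq> 0 \<Longrightarrow> card (progression a d n) = n"
  unfolding progression_def by (subst card_image) (auto simp: inj_on_def)

lemma subset_progressionE:
  assumes "x \<in> S" "S \<subseteq> progression a d n"
  obtains i where "i < n" "x = a + real i * d"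
  using assms unfolding progression_def by blast

text \<open>This symmetry carries results about sums near one end to the other end, and about
  differences \<open>k d\<close> to differences \<open>- k d\<close>.\<close>

lemma progression_reverse:
  "progression a d n = progression (a + (real n - 1) * d) (- d) n"
proof -
  have "progression (a + (real n - 1) * d) (- d) n = (\<lambda>k. a + real k * d) ` (\<lambda>k. n - 1 - k) ` {..<n}"
    unfolding progression_def image_image
    by (intro image_cong refl) (auto simp: of_nat_diff algebra_simps)
  also have "(\<lambda>k. n - 1 - k) ` {..<n} = {..<n}"
  proof (intro equalityI subsetI)
    fix k assume "k \<in> {..<n}"
    then show "k \<in> (\<lambda>k. n - 1 - k) ` {..<n}"
      by (intro image_eqI[of _ _ "n - 1 - k"]) auto
  qed auto
  finally show ?thesis by (simp add: progression_def)
qed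

section \<open>Missing sums\<close>

lemma share_not_in_sumset:
  assumes "d \<noteq> 0" "k < n"
  shows "share (progression a d n) (\<lambda>S. 2 * a + real k * d \<notin> sumset S)
       = (if even k then (3/4) ^ (k div 2) / 2 else (3/4) ^ (k div 2 + 1))"
proof -
  define h where "h i = a + real i * d" for i :: nat
  have h_inj: "h i = h j \<longleftrightarrow> i = j" for i j using assms by (simp add: h_def)
  \<comment> \<open>Stopping at \<open>k div 2\<close> lists every unordered pair of indices with
    sum \<open>k\<close> once, so the blocks are disjoint. For even \<open>k\<close> the last block
    collapses to a single element, which is the source of the factor \<open>1/2\<close>.\<close>
  define A where "A i = {h i, h (k - i)}" for i
  define I where "I = {..k div 2}"
  have "2 * a + real k * d \<notin> sumset S \<longleftrightarrow> (\<forall>i\<in>I. \<not> A i \<subseteq> S)"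
    if S: "S \<subseteq> progression a d n" for S
  proof -
    have "2 * a + real k * d \<in> sumset S \<longleftrightarrow> (\<exists>i\<in>I. A i \<subseteq> S)"
    proof
      assume "2 * a + real k * d \<in> sumset S"
      then obtain s t where st: "s \<in> S" "t \<in> S" "2 * a + real k * d = s + t"
        by (auto simp: sumset_def)
      then obtain i j where ij: "s = h i" "t = h j"
        using S unfolding h_def by (metis subset_progressionE)
      have "real k * d = real (i + j) * d" using st ij by (simp add: h_def algebra_simps)
      then have "k = i + j" using assms by simp
      then have "min i j \<in> I" "A (min i j) \<subseteq> S"
        using st ij by (auto simp: I_def A_def min_def)
      then show "\<exists>i\<in>I. A i \<subseteq> S" by blast
    next
      assume "\<exists>i\<in>I. A i \<subseteq> S"
      then obtain i where "i \<in> I" and i: "h i \<in> S" "h (k - i) \<in> S"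
        by (auto simp: A_def)
      then have "i \<le> k" by (simp add: I_def)
      then have "2 * a + real k * d = h i + h (k - i)"
        by (simp add: h_def of_nat_diff algebra_simps)
      then show "2 * a + real k * d \<in> sumset S"
        using i by (auto simp: sumset_def)
    qed
    then show ?thesis by blast
  qed
  then have "share (progression a d n) (\<lambda>S. 2 * a + real k * d \<notin> sumset S)
      = share (progression a d n) (\<lambda>S. \<forall>i\<in>I. \<not> A i \<subseteq> S)"
    by (rule share_cong)
  also have "\<dots> = (\<Prod>i\<in>I. 1 - 1 / 2 ^ card (A i))"
  proof (rule share_no_block)
    show "A i \<subseteq> progression a d n" if "i \<in> I" for i
      using that assms unfolding A_def I_def h_def progression_def
      by (auto simp del: of_nat_diff)
    show "disjoint_family_on A I"
      by (auto simp: disjoint_family_on_def A_def I_def h_inj)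
  qed (auto simp: I_def)
  also have "\<dots> = (\<Prod>i\<in>I. if 2 * i = k then 1/2 else 3/4)"
    by (intro prod.cong refl) (auto simp: A_def I_def h_inj card_insert_if)
  also have "\<dots> = (if even k then (3/4) ^ (k div 2) / 2 else (3/4) ^ (k div 2 + 1))"
  proof (cases "even k")
    case True
    then obtain m where "k = 2 * m" by blast
    then have I: "I = insert m {..<m}" and "k div 2 = m" by (auto simp: I_def)
    with \<open>k = 2 * m\<close> show ?thesis by (simp add: I)
  next
    case False
    then have "2 * i \<noteq> k" for i by auto
    then show ?thesis using False by (simp add: I_def)
  qed
  finally show ?thesis .
qed

text \<open>The terms for \<open>2 m\<close> and \<open>2 m + 1\<close> together give
  \<open>(5/4) (3/4) ^ m\<close>, so the full series has sum 5; the subtracted term is its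
  tail.\<close>

lemma sum_sumset_shares:
  "(\<Sum>k<n. if even k then (3/4) ^ (k div 2) / 2 else (3/4) ^ (k div 2 + 1) :: real)
     = 5 - (if even n then 5 else 9/2) * (3/4) ^ (n div 2)"
  by (induction n) (auto simp: field_simps elim!: oddE evenE)

lemma mean_sumset_size_progression:
  assumes "d \<noteq> 0" "n > 0"
  defines "q \<equiv> \<lambda>k. if even k then (3/4) ^ (k div 2) / 2 else (3/4) ^ (k div 2 + 1) :: real"
  shows "mean_sumset_size n (progression a d n)
       = 2 * real n - 1 - (\<Sum>k<n. q k) - (\<Sum>k<n - 1. q k)"
proof -
  let ?P = "progression a d n"
  define b where "b = a + (real n - 1) * d"
  have rev: "?P = progression b (- d) n" unfolding b_def by (rule progression_reverse)
  \<comment> \<open>The \<open>2 n - 1\<close> possible sums are numbered from both ends,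
    \<open>n\<close> of them by \<open>f\<close> and the other \<open>n - 1\<close> by
    \<open>g\<close>. Every index is then below \<open>n\<close>, as
    \<open>share_not_in_sumset\<close> demands, with the reversed progression used for
    \<open>g\<close>.\<close>
  define f where "f k = 2 * a + real k * d" for k
  define g where "g k = 2 * b + real k * (- d)" for k
  have inj: "inj_on f X" "inj_on g X" for X using assms by (auto simp: f_def g_def inj_on_def)
  have disj: "f ` {..<n} \<inter> g ` {..<n - 1} = {}"
  proof -
    have "f i \<noteq> g j" if "i < n" "j < n - 1" for i j
    proof
      assume "f i = g j"
      \<comment> \<open>Equality would force \<open>i + j = 2 n - 2\<close>, but the index bounds
        allow at most \<open>2 n - 3\<close>.\<close>
      then have "(real i + real j + 2) * d = 2 * real n * d"
        by (simp add: f_def g_def b_def algebra_simps)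
      then have "real (i + j + 2) = real (2 * n)" using assms by simp
      with that show False by linarith
    qed
    then show ?thesis by auto
  qed
  have sub: "sumset S \<subseteq> f ` {..<n} \<union> g ` {..<n - 1}" if "S \<subseteq> ?P" for S
  proof
    fix x assume "x \<in> sumset S"
    then obtain s t where st: "s \<in> S" "t \<in> S" "x = s + t"
      by (auto simp: sumset_def)
    obtain i where i: "i < n" "s = a + real i * d"
      using st(1) \<open>S \<subseteq> ?P\<close> by (rule subset_progressionE)
    obtain j where j: "j < n" "t = a + real j * d"
      using st(2) \<open>S \<subseteq> ?P\<close> by (rule subset_progressionE)
    have ij: "i < n" "j < n" "x = 2 * a + real (i + j) * d"
      using st i j by (simp_all add: algebra_simps)
    show "x \<in> f ` {..<n} \<union> g ` {..<n - 1}"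
    proof (cases "i + j < n")
      case True
      then show ?thesis using ij(3) unfolding f_def by blast
    next
      case False
      \<comment> \<open>Since \<open>2 b = 2 a + (2 n - 2) d\<close>, the index counted from the
        other end is the complement to \<open>2 n - 2\<close>.\<close>
      have "x = g (2 * n - 2 - (i + j))"
        using ij by (simp add: g_def b_def of_nat_diff algebra_simps)
      moreover have "2 * n - 2 - (i + j) < n - 1" using ij False by auto
      ultimately show ?thesis by blast
    qed
  qed
  have "mean_sumset_size n ?P = real (card (f ` {..<n} \<union> g ` {..<n - 1}))
      - (\<Sum>x\<in>f ` {..<n} \<union> g ` {..<n - 1}. share ?P (\<lambda>S. x \<notin> sumset S))"
    unfolding mean_sumset_size_def using mean_card_eq[OF _ _ sub, of ?P] assms by simp
  also have "\<dots> = 2 * real n - 1 - ((\<Sum>k<n. share ?P (\<lambda>S. f k \<notin> sumset S))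
      + (\<Sum>k<n - 1. share ?P (\<lambda>S. g k \<notin> sumset S)))"
    using assms disj by (simp add: card_Un_disjoint sum.union_disjoint card_image inj
      sum.reindex of_nat_diff)
  also have "(\<Sum>k<n. share ?P (\<lambda>S. f k \<notin> sumset S)) = (\<Sum>k<n. q k)"
    unfolding f_def q_def using assms by (intro sum.cong share_not_in_sumset) auto
  also have "(\<Sum>k<n - 1. share ?P (\<lambda>S. g k \<notin> sumset S)) = (\<Sum>k<n - 1. q k)"
    unfolding g_def q_def rev using assms by (intro sum.cong share_not_in_sumset) auto
  finally show ?thesis by simp
qed

section \<open>Missing differences\<close>

lemma in_diffset_iff:
  assumes "d \<noteq> 0" "S \<subseteq> progression a d n"
  shows "real k * d \<in> diffset S \<longleftrightarrow>
    (\<exists>i<n - k. {a + real i * d, a + real (i + k) * d} \<subseteq> S)"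
proof
  assume "real k * d \<in> diffset S"
  then obtain s t where st: "s \<in> S" "t \<in> S" "real k * d = s - t"
    by (auto simp: diffset_def)
  then obtain i j where ij: "j < n" "s = a + real j * d" "t = a + real i * d"
    using assms(2) by (metis subset_progressionE)
  have "real (i + k) * d = real j * d" using st ij by (simp add: algebra_simps)
  then have "j = i + k" using assms(1) by simp
  then show "\<exists>i<n - k. {a + real i * d, a + real (i + k) * d} \<subseteq> S"
    using st ij by (intro exI[of _ i]) auto
next
  assume "\<exists>i<n - k. {a + real i * d, a + real (i + k) * d} \<subseteq> S"
  then obtain i where "a + real i * d \<in> S" "a + real (i + k) * d \<in> S" by auto
  moreover have "real k * d = (a + real (i + k) * d) - (a + real i * d)"
    by (simp add: algebra_simps)
  ultimately show "real k * d \<in> diffset S"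
    unfolding diffset_def by blast
qed

text \<open>The lower index of a pair is below \<open>n - k \<le> k\<close>, while every upper index
  is at least \<open>k\<close>, so no element belongs to two pairs.\<close>

lemma share_not_in_diffset_large:
  assumes "d \<noteq> 0" "k > 0" "n \<le> 2 * k"
  shows "share (progression a d n) (\<lambda>S. real k * d \<notin> diffset S) = (3/4) ^ (n - k)"
proof -
  define A where "A i = {a + real i * d, a + real (i + k) * d}" for i
  have "share (progression a d n) (\<lambda>S. real k * d \<notin> diffset S)
      = share (progression a d n) (\<lambda>S. \<forall>i\<in>{..<n - k}. \<not> A i \<subseteq> S)"
    by (intro share_cong) (use in_diffset_iff[OF assms(1)] in \<open>auto simp: A_def\<close>)
  also have "\<dots> = (\<Prod>i<n - k. 1 - 1 / 2 ^ card (A i))"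
  proof (rule share_no_block)
    show "A i \<subseteq> progression a d n" if "i \<in> {..<n - k}" for i
      using that unfolding A_def progression_def by (auto simp del: of_nat_add)
    show "disjoint_family_on A {..<n - k}"
      using assms by (auto simp: disjoint_family_on_def A_def simp del: of_nat_add)
  qed auto
  also have "\<dots> = (\<Prod>i<n - k. 3/4)"
    using assms by (intro prod.cong) (auto simp: A_def card_insert_if simp del: of_nat_add)
  finally show ?thesis by simp
qed

lemma share_not_in_diffset_small:
  assumes "d \<noteq> 0" "k > 0" "2 * k \<le> n"
  shows "share (progression a d n) (\<lambda>S. real k * d \<notin> diffset S) \<le> (3/4) ^ (n div 4)"
proof -
  txt \<open>Cut the first \<open>2 k q\<close> positions into consecutive runs of length \<open>k\<close>. The map \<open>f\<close>
    enumerates the runs of even index, and pairing each with the next run gives disjoint pairs.\<close>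
  define q where "q = n div (2 * k)"
  define f where "f i = 2 * k * (i div k) + i mod k" for i
  define A where "A i = {a + real (f i) * d, a + real (f i + k) * d}" for i
  define I where "I = {..<k * q}"
  have f_bound: "f i + k < n" if "i \<in> I" for i
  proof -
    have "i div k < q" using that assms(2) by (simp add: I_def div_less_iff_less_mult mult.commute)
    then have "2 * k * (i div k + 1) \<le> 2 * k * q" by (intro mult_le_mono) auto
    also have "\<dots> \<le> n" by (simp add: q_def)
    finally have "2 * k + 2 * k * (i div k) \<le> n" by (simp add: algebra_simps)
    moreover have "i mod k < k" using assms(2) by simp
    ultimately show ?thesis unfolding f_def by linarith
  qed
  have f_div: "f i div k = 2 * (i div k)" and f_mod: "f i mod k = i mod k" for i
  proof -
    have "f i = i mod k + k * (2 * (i div k))" by (simp add: f_def)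
    then show "f i div k = 2 * (i div k)" "f i mod k = i mod k"
      using assms(2) by simp_all
  qed
  have f_inj: "f i = f j \<longleftrightarrow> i = j" for i j
  proof
    assume "f i = f j"
    then have "i div k = j div k" "i mod k = j mod k"
      using f_div f_mod by (metis mult_left_cancel zero_neq_numeral)+
    then show "i = j" by (metis div_mult_mod_eq)
  qed simp
  \<comment> \<open>A parity argument: \<open>f i\<close> lies in a run of even index and
    \<open>f j + k\<close> in a run of odd index.\<close>
  have f_shift: "f i \<noteq> f j + k" for i j
  proof
    assume "f i = f j + k"
    then have "f i div k = f j div k + 1" using assms(2) by simp
    then have "2 * (i div k) = 2 * (j div k) + 1" unfolding f_div .
    then show False by (metis even_plus_one_iff dvd_triv_left)
  qed
  \<comment> \<open>Only some of the pairs representing \<open>k d\<close> are kept. This relaxes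
    the condition on \<open>S\<close>, hence an upper bound instead of an equality.\<close>
  have "share (progression a d n) (\<lambda>S. real k * d \<notin> diffset S)
      \<le> share (progression a d n) (\<lambda>S. \<forall>i\<in>I. \<not> A i \<subseteq> S)"
  proof (rule share_mono)
    fix S assume S: "S \<subseteq> progression a d n" "real k * d \<notin> diffset S"
    show "\<forall>i\<in>I. \<not> A i \<subseteq> S"
    proof
      fix i assume "i \<in> I"
      then have "f i < n - k" using f_bound[of i] by simp
      then show "\<not> A i \<subseteq> S" using in_diffset_iff[OF assms(1) S(1), of k] S(2) by (auto simp: A_def)
    qed
  qed simp
  also have "\<dots> = (\<Prod>i\<in>I. 1 - 1 / 2 ^ card (A i))"
  proof (rule share_no_block)
    show "A i \<subseteq> progression a d n" if "i \<in> I" for i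
      using f_bound[OF that] unfolding A_def progression_def by (auto simp del: of_nat_add)
    show "disjoint_family_on A I"
      using assms f_inj f_shift f_shift[symmetric]
      by (auto simp: disjoint_family_on_def A_def simp del: of_nat_add)
  qed (auto simp: I_def)
  also have "\<dots> = (\<Prod>i\<in>I. 3/4)"
    using assms by (intro prod.cong) (auto simp: A_def card_insert_if simp del: of_nat_add)
  also have "\<dots> = (3/4) ^ (k * q)" by (simp add: I_def)
  also have "\<dots> \<le> (3/4) ^ (n div 4)"
  proof (rule power_decreasing)
    \<comment> \<open>The remainder is below \<open>2 k \<le> 2 k q\<close>, hence
      \<open>n < 4 k q\<close>.\<close>
    have "n = 2 * (k * q) + n mod (2 * k)" by (simp add: q_def flip: mult.assoc)
    moreover have "n mod (2 * k) < 2 * k" using assms(2) by simp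
    moreover have "q \<ge> 1" using assms by (simp add: q_def div_greater_zero_iff Suc_le_eq)
    then have "k \<le> k * q" by simp
    ultimately show "n div 4 \<le> k * q" by linarith
  qed auto
  finally show ?thesis .
qed

text \<open>For \<open>2 k < n\<close> the power \<open>(3/4) ^ (n - k)\<close> is not claimed to be
  the share; both numbers merely lie between 0 and the error bound. Using it for every
  \<open>k\<close> makes the comparison terms a complete geometric sum.\<close>

lemma share_not_in_diffset:
  assumes "d \<noteq> 0" "k > 0"
  shows "\<bar>share (progression a d n) (\<lambda>S. real k * d \<notin> diffset S) - (3/4) ^ (n - k)\<bar>
       \<le> (3/4) ^ (n div 4)"
proof (cases "n \<le> 2 * k")
  case True
  then show ?thesis using share_not_in_diffset_large[OF assms True] by simp
next
  case False
  then have "(3/4 :: real) ^ (n - k) \<le> (3/4) ^ (n div 4)"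
    by (intro power_decreasing) auto
  moreover have "share (progression a d n) (\<lambda>S. real k * d \<notin> diffset S) \<le> (3/4) ^ (n div 4)"
    using share_not_in_diffset_small[OF assms] False by simp
  moreover have "(3/4 :: real) ^ (n - k) \<ge> 0" by simp
  ultimately show ?thesis
    using share_nonneg[of "progression a d n" "\<lambda>S. real k * d \<notin> diffset S"] by linarith
qed

text \<open>\<open>3 - 4 * (3/4) ^ n\<close> is the geometric sum of the comparison terms, and each
  of the \<open>n - 1\<close> errors obeys the same bound.\<close>

lemma sum_share_not_in_diffset:
  assumes "d \<noteq> 0" "n > 0"
  shows "\<bar>(\<Sum>k=1..<n. share (progression a d n) (\<lambda>S. real k * d \<notin> diffset S)) - (3 - 4 * (3/4) ^ n)\<bar>
       \<le> real n * (3/4) ^ (n div 4)"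
proof -
  have "(\<Sum>k=1..<n. (3/4) ^ (n - k)) = (\<Sum>k=1..<n. (3/4 :: real) ^ k)"
    by (rule sum.reindex_bij_witness[where i = "\<lambda>k. n - k" and j = "\<lambda>k. n - k"]) auto
  also have "\<dots> = 3 - 4 * (3/4) ^ n"
    using assms(2) by (induction n rule: nat_induct_non_zero) (auto simp: field_simps)
  finally have "(\<Sum>k=1..<n. share (progression a d n) (\<lambda>S. real k * d \<notin> diffset S)) - (3 - 4 * (3/4) ^ n)
      = (\<Sum>k=1..<n. share (progression a d n) (\<lambda>S. real k * d \<notin> diffset S) - (3/4) ^ (n - k))"
    by (simp add: sum_subtractf)
  also have "\<bar>\<dots>\<bar> \<le> (\<Sum>k=1..<n. (3/4) ^ (n div 4))"
    by (rule order_trans[OF sum_abs], rule sum_mono)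
      (use share_not_in_diffset[OF assms(1)] in auto)
  also have "\<dots> \<le> real n * (3/4) ^ (n div 4)"
    by (simp add: mult_right_mono)
  finally show ?thesis .
qed

lemma mean_diffset_size_progression:
  assumes "d \<noteq> 0" "n > 0"
  shows "mean_diffset_size n (progression a d n) = 2 * real n - 1 - 1 / 2 ^ n
       - (\<Sum>k=1..<n. share (progression a d n) (\<lambda>S. real k * d \<notin> diffset S))
       - (\<Sum>k=1..<n. share (progression a d n) (\<lambda>S. real k * (- d) \<notin> diffset S))"
proof -
  let ?P = "progression a d n"
  define f where "f k = real k * d" for k
  define g where "g k = real k * (- d)" for k
  define T where "T = insert 0 (f ` {1..<n} \<union> g ` {1..<n})"
  have inj: "inj_on f X" "inj_on g X" for X using assms by (auto simp: f_def g_def inj_on_def)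
  have disj: "f ` {1..<n} \<inter> g ` {1..<n} = {}"
  proof -
    have "f i \<noteq> g j" if "1 \<le> i" for i j
    proof
      assume "f i = g j"
      then have "(real i + real j) * d = 0" by (simp add: f_def g_def algebra_simps)
      then show False using assms that by simp
    qed
    then show ?thesis by auto
  qed
  have zero: "0 \<notin> f ` {1..<n} \<union> g ` {1..<n}" using assms by (auto simp: f_def g_def)
  have sub: "diffset S \<subseteq> T" if "S \<subseteq> ?P" for S
  proof
    fix x assume "x \<in> diffset S"
    then obtain s t where st: "s \<in> S" "t \<in> S" "x = s - t"
      by (auto simp: diffset_def)
    obtain i where i: "i < n" "s = a + real i * d"
      using st(1) \<open>S \<subseteq> ?P\<close> by (rule subset_progressionE)
    obtain j where j: "j < n" "t = a + real j * d"
      using st(2) \<open>S \<subseteq> ?P\<close> by (rule subset_progressionE)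
    have ij: "i < n" "j < n" "x = real i * d - real j * d"
      using st i j by simp_all
    consider "i = j" | "j < i" | "i < j" by linarith
    then show "x \<in> T"
    proof cases
      case 2
      then have "x = f (i - j)" "i - j \<in> {1..<n}"
        using ij by (auto simp: f_def of_nat_diff algebra_simps)
      then show ?thesis by (auto simp: T_def)
    next
      case 3
      then have "x = g (j - i)" "j - i \<in> {1..<n}"
        using ij by (auto simp: g_def of_nat_diff algebra_simps)
      then show ?thesis by (auto simp: T_def)
    qed (use ij in \<open>auto simp: T_def\<close>)
  qed
  \<comment> \<open>Any element minus itself gives 0, so only the empty set misses it. This produces
    the term \<open>1 / 2 ^ n\<close>.\<close>
  have "{S \<in> Pow ?P. 0 \<notin> diffset S} = {{}}"
    by (auto simp: diffset_def)
  then have share_zero: "share ?P (\<lambda>S. 0 \<notin> diffset S) = 1 / 2 ^ n"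
    using assms by (simp add: share_def)
  have "mean_diffset_size n ?P = real (card T) - (\<Sum>x\<in>T. share ?P (\<lambda>S. x \<notin> diffset S))"
    unfolding mean_diffset_size_def using mean_card_eq[OF _ _ sub, of ?P] assms by (simp add: T_def)
  also have "real (card T) = 2 * real n - 1"
    using assms disj zero by (simp add: T_def card_Un_disjoint card_image inj of_nat_diff)
  also have "(\<Sum>x\<in>T. share ?P (\<lambda>S. x \<notin> diffset S)) = 1 / 2 ^ n
      + ((\<Sum>k=1..<n. share ?P (\<lambda>S. f k \<notin> diffset S))
      + (\<Sum>k=1..<n. share ?P (\<lambda>S. g k \<notin> diffset S)))"
    using zero disj share_zero
    by (simp add: T_def sum.union_disjoint sum.reindex[OF inj(1)] sum.reindex[OF inj(2)] o_def)
  finally show ?thesis by (simp add: f_def g_def)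
qed

section \<open>Limits and asymptotic equivalence\<close>

lemma times_power_div_tendsto_zero:
  fixes x :: real
  assumes x: "0 \<le> x" "x < 1" and m: "m > 0"
  shows "(\<lambda>n. real n * x ^ (n div m)) \<longlonglongrightarrow> 0"
proof (rule Lim_null_comparison)
  \<comment> \<open>This bounds the sequence by \<open>m (k + 1) x ^ k\<close> evaluated at
    \<open>k = n div m\<close>, which tends to infinity with \<open>n\<close>.\<close>
  have "real n \<le> real m * (real (n div m) + 1)" for n
  proof -
    have "n < m * (n div m + 1)"
      using dividend_less_div_times[of m n] m by (simp add: algebra_simps)
    then have "real n < real (m * (n div m + 1))" by (simp only: of_nat_less_iff)
    then show ?thesis by (simp add: algebra_simps)
  qed
  then show "\<forall>\<^sub>F n in sequentially. norm (real n * x ^ (n div m))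
      \<le> real m * (real (n div m) + 1) * x ^ (n div m)"
    using x by (simp add: mult_right_mono)
  have "(\<lambda>k. real m * (real k * x ^ k + x ^ k)) \<longlonglongrightarrow> 0"
    by (intro tendsto_mult_right_zero tendsto_add_zero powser_times_n_limit_0 LIMSEQ_power_zero) (use x in auto)
  from filterlim_compose[OF this filterlim_at_top_div_const_nat[OF m]]
  show "(\<lambda>n. real m * (real (n div m) + 1) * x ^ (n div m)) \<longlonglongrightarrow> 0"
    by (simp add: algebra_simps)
qed

text \<open>The error bound depends on \<open>n\<close> alone and not on \<open>a\<close> and
  \<open>d\<close>, so the progressions may be chosen independently for each
  \<open>n\<close>.\<close>

lemma mean_sumset_size_limit:
  assumes "\<And>n. arith_prog n (P n)"
  shows "(\<lambda>n. mean_sumset_size n (P n) - (2 * real n - 11)) \<longlonglongrightarrow> 0"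
proof (rule Lim_null_comparison)
  show "\<forall>\<^sub>F n in sequentially. norm (mean_sumset_size n (P n) - (2 * real n - 11))
      \<le> 14 * (real n * (3/4) ^ (n div 2))"
    using eventually_gt_at_top[of 0]
  proof eventually_elim
    case (elim n)
    obtain a d where "d \<noteq> 0" and P: "P n = progression a d n"
      using assms[of n] by (auto simp: arith_prog_def progression_def)
    \<comment> \<open>The two tails are at most \<open>5 c\<close> and \<open>5 (4/3) c\<close>, so
      14 is a generous constant. The extra factor \<open>n\<close> in the bound only brings it into
      the form of \<open>times_power_div_tendsto_zero\<close>.\<close>
    define c where "c = (3/4 :: real) ^ (n div 2)"
    have "(3/4 :: real) ^ ((n - 1) div 2) \<le> 4 / 3 * c"
    proof -
      have "(3/4 :: real) ^ ((n - 1) div 2) = 4 / 3 * (3/4) ^ (Suc ((n - 1) div 2))" by simp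
      also have "\<dots> \<le> 4 / 3 * c"
        unfolding c_def by (intro mult_left_mono power_decreasing) auto
      finally show ?thesis .
    qed
    moreover have "c \<ge> 0" "(3/4 :: real) ^ ((n - 1) div 2) \<ge> 0" by (simp_all add: c_def)
    moreover have "mean_sumset_size n (P n) - (2 * real n - 11)
       = (if even n then 5 else 9/2) * c + (if even (n - 1) then 5 else 9/2) * (3/4) ^ ((n - 1) div 2)"
      unfolding P mean_sumset_size_progression[OF \<open>d \<noteq> 0\<close> elim] sum_sumset_shares c_def by simp
    ultimately have "norm (mean_sumset_size n (P n) - (2 * real n - 11)) \<le> 14 * c"
      by (auto split: if_splits)
    also have "\<dots> \<le> 14 * (real n * c)"
      using elim \<open>c \<ge> 0\<close> by (simp add: mult_le_cancel_right1)
    finally show ?case by (simp add: c_def)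
  qed
  show "(\<lambda>n. 14 * (real n * (3/4) ^ (n div 2))) \<longlonglongrightarrow> 0"
    using tendsto_mult_right_zero[OF times_power_div_tendsto_zero[of "3/4" 2]] by simp
qed

lemma mean_diffset_size_limit:
  assumes "\<And>n. arith_prog n (P n)"
  shows "(\<lambda>n. mean_diffset_size n (P n) - (2 * real n - 7)) \<longlonglongrightarrow> 0"
proof (rule Lim_null_comparison)
  \<comment> \<open>Both signs contribute a main term \<open>3 - 4 * (3/4) ^ n\<close>: the two 3s
    turn \<open>2 n - 1\<close> into \<open>2 n - 7\<close>, and the powers leave
    \<open>8 * (3/4) ^ n\<close>. The term \<open>1 / 2 ^ n\<close> comes from the difference
    0.\<close>
  show "\<forall>\<^sub>F n in sequentially. norm (mean_diffset_size n (P n) - (2 * real n - 7))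
      \<le> 2 * (real n * (3/4) ^ (n div 4)) + (8 * (3/4) ^ n + 1 / 2 ^ n)"
    using eventually_gt_at_top[of 0]
  proof eventually_elim
    case (elim n)
    obtain a d where d: "d \<noteq> 0" and P: "P n = progression a d n"
      using assms[of n] by (auto simp: arith_prog_def progression_def)
    define b where "b = a + (real n - 1) * d"
    \<comment> \<open>Read backwards, the progression has common difference \<open>- d\<close>, so
      the estimate for positive multiples of the common difference also covers the differences
      \<open>- k d\<close>.\<close>
    have rev: "P n = progression b (- d) n" unfolding b_def P by (rule progression_reverse)
    have "mean_diffset_size n (P n) = 2 * real n - 1 - 1 / 2 ^ n
       - (\<Sum>k=1..<n. share (P n) (\<lambda>S. real k * d \<notin> diffset S))
       - (\<Sum>k=1..<n. share (P n) (\<lambda>S. real k * (- d) \<notin> diffset S))"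
      unfolding P by (rule mean_diffset_size_progression[OF d elim])
    moreover have "\<bar>(\<Sum>k=1..<n. share (P n) (\<lambda>S. real k * d \<notin> diffset S)) - (3 - 4 * (3/4) ^ n)\<bar>
       \<le> real n * (3/4) ^ (n div 4)"
      unfolding P by (rule sum_share_not_in_diffset[OF d elim])
    moreover have "\<bar>(\<Sum>k=1..<n. share (P n) (\<lambda>S. real k * (- d) \<notin> diffset S)) - (3 - 4 * (3/4) ^ n)\<bar>
       \<le> real n * (3/4) ^ (n div 4)"
      unfolding rev by (rule sum_share_not_in_diffset) (use d elim in auto)
    moreover have "(3/4 :: real) ^ n \<ge> 0" "1 / 2 ^ n \<ge> (0 :: real)" by simp_all
    ultimately show ?case unfolding real_norm_def by linarith
  qed
  have "(\<lambda>n. 1 / 2 ^ n :: real) \<longlonglongrightarrow> 0"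
    using LIMSEQ_power_zero[of "1/2 :: real"] by (simp add: power_divide)
  moreover have "(\<lambda>n. (3/4 :: real) ^ n) \<longlonglongrightarrow> 0"
    by (rule LIMSEQ_power_zero) simp
  ultimately show "(\<lambda>n. 2 * (real n * (3/4) ^ (n div 4)) + (8 * (3/4) ^ n + 1 / 2 ^ n)) \<longlonglongrightarrow> 0"
    by (intro tendsto_add_zero tendsto_mult_right_zero times_power_div_tendsto_zero) auto
qed

lemma asymp_equiv_of_diff_tendsto_zero:
  fixes f g :: "nat \<Rightarrow> real"
  assumes "(\<lambda>n. f n - g n) \<longlonglongrightarrow> 0" "filterlim g at_top at_top"
  shows "f \<sim>[at_top] g"
proof (rule smallo_imp_asymp_equiv, rule smalloI_tendsto)
  show "(\<lambda>n. (f n - g n) / g n) \<longlonglongrightarrow> 0"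
    using assms by (rule real_tendsto_divide_at_top)
  show "\<forall>\<^sub>F n in at_top. g n \<noteq> 0"
    using filterlim_at_top_dense[THEN iffD1, OF assms(2), rule_format, of 0]
    by (rule eventually_mono) simp
qed

text \<open>Asymptotic equivalence alone does not detect the constants 7 and 11. The limits of the
  differences record them, and they yield both the equivalences and the gap of 4.\<close>

theorem theorem3:
  fixes P :: "nat \<Rightarrow> real set"
  assumes "\<And>n. arith_prog n (P n)"
  shows "((\<lambda>n. mean_diffset_size n (P n)) \<sim>[at_top] (\<lambda>n. 2 * real n - 7)) \<and>
         ((\<lambda>n. mean_sumset_size n (P n)) \<sim>[at_top] (\<lambda>n. 2 * real n - 11)) \<and>
         (\<lambda>n. mean_diffset_size n (P n) - (2 * real n - 7)) \<longlonglongrightarrow> 0 \<and>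
         (\<lambda>n. mean_sumset_size n (P n) - (2 * real n - 11)) \<longlonglongrightarrow> 0 \<and>
         (\<lambda>n. mean_diffset_size n (P n) - mean_sumset_size n (P n)) \<longlonglongrightarrow> 4"
proof (intro conjI)
  show D: "(\<lambda>n. mean_diffset_size n (P n) - (2 * real n - 7)) \<longlonglongrightarrow> 0"
    by (rule mean_diffset_size_limit[OF assms])
  show S: "(\<lambda>n. mean_sumset_size n (P n) - (2 * real n - 11)) \<longlonglongrightarrow> 0"
    by (rule mean_sumset_size_limit[OF assms])
  show "(\<lambda>n. mean_diffset_size n (P n)) \<sim>[at_top] (\<lambda>n. 2 * real n - 7)"
    by (rule asymp_equiv_of_diff_tendsto_zero[OF D]) real_asymp
  show "(\<lambda>n. mean_sumset_size n (P n)) \<sim>[at_top] (\<lambda>n. 2 * real n - 11)"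
    by (rule asymp_equiv_of_diff_tendsto_zero[OF S]) real_asymp
  show "(\<lambda>n. mean_diffset_size n (P n) - mean_sumset_size n (P n)) \<longlonglongrightarrow> 4"
    using tendsto_add[OF tendsto_diff[OF D S] tendsto_const[of 4]] by simp
qed

end
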